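(* For $q>1$ and $|u|<q$, $$\sum_{n \geq 0} u^n q^{n^2} \sum_{r=0}^n \frac{1}{|Sp(2r,q)|\,|Sp(2n-2r,q)|} = \frac{ \prod_{i \geq 1} (1+u/q^{2i})^2 }{\prod_{i \geq 1} (1-u^2/q^{2i}) } .$$
   Context: Here $q$ is a real number, $u$ is a complex number, and $|Sp(2m,q)|$ denotes the expression $|Sp(2m,q)|=q^{m^2}\prod_{i=1}^m (q^{2i}-1)$ for $m\ge 0$ (so $|Sp(0,q)|=1$), which for a prime power $q$ is the order of the symplectic group. *)

theory Defs
  imports "HOL-Analysis.Analysis"
begin

(* Sp_order m q is |Sp(2m,q)|: the first argument is half the dimension. *)
definition Sp_order :: "nat \<Rightarrow> real \<Rightarrow> real" where
  "Sp_order m q = q ^ (m\<^sup>2) * (\<Prod>i=1..m. (q ^ (2 * i) - 1))"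

end

theory Submission
  imports Defs
begin

text \<open>Put \<open>y = 1/q\<close>, \<open>x = y\<^sup>2\<close> and \<open>z = u/q\<close>. The exponents of \<open>q\<close> combine into a square, so
  the left-hand side is the sum over all \<open>r\<close>, \<open>s\<close> of
  \<open>z ^ (r + s) * y ^ (r - s)\<^sup>2 / ((x;x)\<^sub>r (x;x)\<^sub>s)\<close>. For fixed \<open>r\<close>, Euler's product identity evaluates the sum
  over \<open>s\<close> as the \<open>r\<close>-independent infinite product \<open>(-zy;x)\<^sub>\<infinity>\<close> times a finite product, and the
  \<open>q\<close>-binomial theorem then evaluates the sum over \<open>r\<close>.\<close>

section \<open>Finite and infinite q-Pochhammer symbols\<close>

text \<open>The symbol (a;x)_n. It is polymorphic so that it serves both the real group orders and
  the complex series.\<close>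

definition qpoch :: "'a::comm_ring_1 \<Rightarrow> 'a \<Rightarrow> nat \<Rightarrow> 'a" where
  "qpoch a x n = (\<Prod>j<n. 1 - a * x ^ j)"

definition qpoch_inf :: "complex \<Rightarrow> complex \<Rightarrow> complex" where
  "qpoch_inf a x = (\<Prod>j. 1 - a * x ^ j)"

lemma qpoch_0 [simp]: "qpoch a x 0 = 1"
  by (simp add: qpoch_def)

lemma qpoch_Suc: "qpoch a x (Suc n) = qpoch a x n * (1 - a * x ^ n)"
  by (simp add: qpoch_def)

lemma convergent_prod_qpoch:
  fixes a x :: complex
  assumes "norm x < 1"
  shows "convergent_prod (\<lambda>j. 1 - a * x ^ j)"
proof -
  have "summable (\<lambda>j. norm a * norm x ^ j)"
    using assms by (intro summable_mult summable_geometric) auto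
  then show ?thesis
    by (intro abs_convergent_prod_imp_convergent_prod summable_imp_abs_convergent_prod)
       (simp add: norm_mult norm_power)
qed

lemma qpoch_LIMSEQ:
  fixes a x :: complex
  assumes "norm x < 1"
  shows "qpoch a x \<longlonglongrightarrow> qpoch_inf a x"
  using convergent_prod_LIMSEQ[OF convergent_prod_qpoch[OF assms]]
  unfolding qpoch_def[abs_def] qpoch_inf_def by (simp only: LIMSEQ_lessThan_iff_atMost)

lemma qpoch_factor_nonzero:
  fixes a x :: complex
  assumes "norm x < 1" "norm a < 1"
  shows "1 - a * x ^ j \<noteq> 0"
proof -
  have "norm (a * x ^ j) \<le> norm a * 1"
    unfolding norm_mult norm_power using assms by (intro mult_left_mono power_le_one) auto
  with assms have "norm (a * x ^ j) < 1" by simp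
  then show ?thesis by auto
qed

lemma qpoch_nonzero:
  fixes a x :: complex
  assumes "norm x < 1" "norm a < 1"
  shows "qpoch a x n \<noteq> 0"
  unfolding qpoch_def using qpoch_factor_nonzero[OF assms] by simp

lemma qpoch_inf_nonzero:
  assumes "norm x < 1" "norm a < 1"
  shows "qpoch_inf a x \<noteq> 0"
  unfolding qpoch_inf_def
  using assms by (intro prodinf_nonzero convergent_prod_qpoch qpoch_factor_nonzero)

text \<open>Split off the first factor of each partial product and pass to the limit.\<close>

lemma qpoch_inf_rec:
  assumes "norm x < 1"
  shows "qpoch_inf a x = (1 - a) * qpoch_inf (a * x) x"
proof -
  have "qpoch a x (Suc n) = (1 - a) * qpoch (a * x) x n" for n
    unfolding qpoch_def by (subst prod.lessThan_Suc_shift) (simp add: mult.assoc)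
  moreover have "(\<lambda>n. qpoch a x (Suc n)) \<longlonglongrightarrow> qpoch_inf a x"
    using qpoch_LIMSEQ[OF assms] by (rule LIMSEQ_Suc)
  moreover have "(\<lambda>n. (1 - a) * qpoch (a * x) x n) \<longlonglongrightarrow> (1 - a) * qpoch_inf (a * x) x"
    using qpoch_LIMSEQ[OF assms] by (rule tendsto_mult_left)
  ultimately show ?thesis
    using LIMSEQ_unique by fastforce
qed

text \<open>The reciprocals converge because the infinite product is nonzero. The uniform bound
  later controls the denominators of the double series.\<close>

lemma inverse_qpoch_bounded:
  fixes a x :: complex
  assumes "norm x < 1" "norm a < 1"
  obtains K where "0 < K" "\<And>n. norm (1 / qpoch a x n) \<le> K"
proof -
  have "(\<lambda>n. 1 / qpoch a x n) \<longlonglongrightarrow> 1 / qpoch_inf a x"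
    using assms by (intro tendsto_divide tendsto_const qpoch_LIMSEQ qpoch_inf_nonzero)
  then have "Bseq (\<lambda>n. 1 / qpoch a x n)"
    using convergentI convergent_imp_Bseq by blast
  then show ?thesis
    using that BseqE by blast
qed

section \<open>The q-binomial theorem\<close>

text \<open>The product \<open>\<Prod>j<n. b - c * x ^ j\<close> is \<open>b ^ n * qpoch (c / b) x n\<close>, in a form that also covers
  \<open>b = 0\<close>, where the theorem becomes Euler's identity.\<close>

theorem q_binomial:
  fixes a b c x :: complex
  assumes x: "norm x < 1" and ab: "norm (a * b) < 1"
  shows "(\<lambda>n. (\<Prod>j<n. b - c * x ^ j) / qpoch x x n * a ^ n) sums (qpoch_inf (a * c) x / qpoch_inf (a * b) x)"
proof -
  define t where "t n = (\<Prod>j<n. b - c * x ^ j) / qpoch x x n" for n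
  define f where "f w = (\<Sum>n. t n * w ^ n)" for w
  have nz: "1 - x * x ^ n \<noteq> 0" for n
    using qpoch_factor_nonzero[OF x x] .
  have t_Suc: "t (Suc n) = t n * ((b - c * x ^ n) / (1 - x * x ^ n))" for n
    by (simp add: t_def qpoch_Suc)
  have summable_t: "summable (\<lambda>n. t n * w ^ n)" if w: "norm (w * b) < 1" for w
  proof -
    have x0: "(\<lambda>n. x ^ n) \<longlonglongrightarrow> 0"
      using x by (rule LIMSEQ_power_zero)
    have "(\<lambda>n. norm (w * ((b - c * x ^ n) / (1 - x * x ^ n)))) \<longlonglongrightarrow> norm (w * ((b - c * 0) / (1 - x * 0)))"
      by (intro tendsto_intros x0) auto
    then have lim: "(\<lambda>n. norm (w * ((b - c * x ^ n) / (1 - x * x ^ n)))) \<longlonglongrightarrow> norm (w * b)"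
      by simp
    \<comment> \<open>The ratios of consecutive terms tend to \<open>norm (w * b)\<close>, so any
      \<open>\<rho>\<close> strictly between this limit and 1 serves the ratio test from some
      \<open>N\<close> on.\<close>
    obtain \<rho> where \<rho>: "norm (w * b) < \<rho>" "\<rho> < 1"
      using dense[OF w] by blast
    from order_tendstoD(2)[OF lim \<rho>(1)] obtain N
      where N: "\<And>n. n \<ge> N \<Longrightarrow> norm (w * ((b - c * x ^ n) / (1 - x * x ^ n))) < \<rho>"
      by (auto simp: eventually_at_top_linorder)
    show ?thesis
    proof (rule summable_ratio_test[OF \<rho>(2)])
      fix n assume "n \<ge> N"
      have "norm (t (Suc n) * w ^ Suc n)
          = norm (w * ((b - c * x ^ n) / (1 - x * x ^ n))) * norm (t n * w ^ n)"
        unfolding t_Suc by (simp add: norm_mult norm_divide norm_power)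
      also have "\<dots> \<le> \<rho> * norm (t n * w ^ n)"
        using N[OF \<open>n \<ge> N\<close>] by (intro mult_right_mono) auto
      finally show "norm (t (Suc n) * w ^ Suc n) \<le> \<rho> * norm (t n * w ^ n)" .
    qed
  qed
  have shrink: "norm (w * x ^ n * b) < 1" if w: "norm (w * b) < 1" for w n
  proof -
    have "norm (w * b) * norm x ^ n \<le> norm (w * b) * 1"
      using x by (intro mult_left_mono power_le_one) auto
    with w show ?thesis
      by (simp add: norm_mult norm_power mult_ac)
  qed
  \<comment> \<open>A functional equation for the generating function: clearing the denominator in
    \<open>t_Suc\<close> expresses the coefficients of \<open>f w - f (w * x)\<close> through those
    of \<open>f w\<close> and \<open>f (w * x)\<close>, shifted by one.\<close>
  have f_rec: "(1 - w * b) * f w = (1 - w * c) * f (w * x)" if w: "norm (w * b) < 1" for w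
  proof -
    have 1: "(\<lambda>n. t n * w ^ n) sums f w"
      unfolding f_def using summable_t[OF w] by (rule summable_sums)
    have 2: "(\<lambda>n. t n * (w * x) ^ n) sums f (w * x)"
      unfolding f_def using summable_t[of "w * x"] shrink[OF w, of 1] by (intro summable_sums) simp
    have "t (Suc n) * w ^ Suc n - t (Suc n) * (w * x) ^ Suc n
        = w * b * (t n * w ^ n) - w * c * (t n * (w * x) ^ n)" for n
    proof -
      have "t (Suc n) * (1 - x * x ^ n) = t n * (b - c * x ^ n)"
        unfolding t_Suc using nz by simp
      then have "t (Suc n) * (1 - x * x ^ n) * w ^ Suc n = t n * (b - c * x ^ n) * w ^ Suc n"
        by simp
      then show ?thesis
        by (simp add: algebra_simps power_mult_distrib)
    qed
    with sums_diff[OF sums_mult[OF 1, of "w * b"] sums_mult[OF 2, of "w * c"]]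
    have "(\<lambda>n. t (Suc n) * w ^ Suc n - t (Suc n) * (w * x) ^ Suc n) sums
        (w * b * f w - w * c * f (w * x))"
      by simp
    \<comment> \<open>The added term at index 0 is \<open>t 0 - t 0 = 0\<close>, so the value of the
      sum does not change.\<close>
    from sums_Suc[OF this]
    have "(\<lambda>n. t n * w ^ n - t n * (w * x) ^ n) sums (w * b * f w - w * c * f (w * x))"
      by simp
    from sums_unique2[OF this sums_diff[OF 1 2]] show ?thesis
      by (simp add: algebra_simps)
  qed
  \<comment> \<open>Iterate the functional equation along a, ax, ax^2, ...; since these points tend
    to 0 and \<open>f 0 = 1\<close>, the limit gives the product formula.\<close>
  have f_iter: "qpoch (a * b) x n * f a = qpoch (a * c) x n * f (a * x ^ n)" for n
  proof (induction n)
    case (Suc n)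
    have "qpoch (a * b) x (Suc n) * f a = (1 - a * x ^ n * b) * (qpoch (a * b) x n * f a)"
      by (simp add: qpoch_Suc mult_ac)
    also have "\<dots> = qpoch (a * c) x n * ((1 - a * x ^ n * b) * f (a * x ^ n))"
      unfolding Suc by (simp add: mult_ac)
    also have "\<dots> = qpoch (a * c) x (Suc n) * f (a * x ^ Suc n)"
      unfolding f_rec[OF shrink[OF ab]] by (simp add: qpoch_Suc mult_ac)
    finally show ?case .
  qed simp
  have f0: "f 0 = 1"
    unfolding f_def powser_zero by (simp add: t_def)
  have "(\<lambda>n. f (a * x ^ n)) \<longlonglongrightarrow> 1"
  \<comment> \<open>For nonzero \<open>a\<close> the series converges at \<open>a\<close> itself,
    hence is continuous at 0; for \<open>a = 0\<close> the sequence is constant.\<close>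
  proof (cases "a = 0")
    case False
    have "isCont f 0"
      unfolding f_def[abs_def] using summable_t[OF ab] False by (intro isCont_powser[of _ a]) auto
    moreover have "(\<lambda>n. a * x ^ n) \<longlonglongrightarrow> 0"
      using tendsto_mult_left[OF LIMSEQ_power_zero[OF x], of a] by simp
    ultimately show ?thesis
      using isCont_tendsto_compose f0 by metis
  qed (simp add: f0)
  then have "(\<lambda>n. qpoch (a * c) x n * f (a * x ^ n)) \<longlonglongrightarrow> qpoch_inf (a * c) x * 1"
    by (intro tendsto_mult qpoch_LIMSEQ x)
  moreover have "(\<lambda>n. qpoch (a * b) x n * f a) \<longlonglongrightarrow> qpoch_inf (a * b) x * f a"
    by (intro tendsto_mult tendsto_const qpoch_LIMSEQ x)
  ultimately have "qpoch_inf (a * b) x * f a = qpoch_inf (a * c) x"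
    unfolding f_iter using LIMSEQ_unique by fastforce
  then have "f a = qpoch_inf (a * c) x / qpoch_inf (a * b) x"
    using qpoch_inf_nonzero[OF x ab] by (simp add: field_simps)
  then show ?thesis
    using summable_sums[OF summable_t[OF ab]] unfolding f_def t_def by simp
qed

section \<open>Euler's identity with square exponents\<close>

text \<open>The exponents 2j for j < n add up to n(n-1); the extra factor \<open>y ^ n\<close>
  completes the square. Base \<open>y ^ 2\<close> avoids halved exponents.\<close>

lemma prod_power_double:
  fixes y :: "'a::comm_monoid_mult"
  shows "(\<Prod>j<n. (y ^ 2) ^ j) * y ^ n = y ^ (n\<^sup>2)"
proof (induction n)
  case (Suc n)
  have "(\<Prod>j<Suc n. (y ^ 2) ^ j) * y ^ Suc n = ((\<Prod>j<n. (y ^ 2) ^ j) * y ^ n) * y ^ (2 * n + 1)"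
    by (simp add: power_mult[symmetric] power_add[symmetric] mult_ac mult_2)
  also have "\<dots> = y ^ ((Suc n)\<^sup>2)"
    unfolding Suc power_add[symmetric] by (rule arg_cong) (simp add: power2_eq_square)
  finally show ?case .
qed simp

lemma euler_square_sums:
  fixes b y :: complex
  assumes "norm y < 1"
  shows "(\<lambda>s. y ^ (s\<^sup>2) / qpoch (y\<^sup>2) (y\<^sup>2) s * b ^ s) sums qpoch_inf (- (b * y)) (y\<^sup>2)"
proof -
  have y2: "norm (y\<^sup>2) < 1"
    using assms by (simp add: norm_power power_less_one_iff)
  \<comment> \<open>Apply \<open>q_binomial\<close> with \<open>a := b * y\<close>,
    \<open>b := 0\<close>, \<open>c := -1\<close>; the infinite product in the denominator then
    becomes 1.\<close>
  have "(\<lambda>s. (\<Prod>j<s. 0 - (-1) * (y\<^sup>2) ^ j) / qpoch (y\<^sup>2) (y\<^sup>2) s * (b * y) ^ s) sums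
      (qpoch_inf (b * y * (-1)) (y\<^sup>2) / qpoch_inf (b * y * 0) (y\<^sup>2))"
    using y2 by (intro q_binomial) auto
  moreover have "(\<Prod>j<s. 0 - (-1) * (y\<^sup>2) ^ j) / qpoch (y\<^sup>2) (y\<^sup>2) s * (b * y) ^ s
      = y ^ (s\<^sup>2) / qpoch (y\<^sup>2) (y\<^sup>2) s * b ^ s" for s
    using prod_power_double[of y s] by (simp add: power_mult_distrib mult_ac)
  moreover have "qpoch_inf 0 (y\<^sup>2) = 1"
    by (simp add: qpoch_inf_def)
  ultimately show ?thesis
    by (simp only: mult_minus_right mult_1_right mult_zero_right div_by_1)
qed

text \<open>The detour through the integers avoids truncated subtraction, while the result can still
  serve as an exponent.\<close>

definition sqdist :: "nat \<Rightarrow> nat \<Rightarrow> nat" where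
  "sqdist r s = nat ((int r - int s)\<^sup>2)"

lemma sqdist_add: "sqdist r s + 2 * (r * s) = r\<^sup>2 + s\<^sup>2"
proof -
  have "int (sqdist r s + 2 * (r * s)) = (int r - int s)\<^sup>2 + 2 * (int r * int s)"
    by (simp add: sqdist_def)
  also have "\<dots> = int (r\<^sup>2 + s\<^sup>2)"
    by (simp add: power2_eq_square algebra_simps)
  finally have "int (sqdist r s + 2 * (r * s)) = int (r\<^sup>2 + s\<^sup>2)" .
  then show ?thesis by (simp only: of_nat_eq_iff)
qed

text \<open>Since (r-s)^2 = r^2 + s^2 - 2rs, this is \<open>y ^ (r\<^sup>2)\<close> times Euler's
  series at \<open>b / y ^ (2 * r)\<close>. The product there has r additional leading factors,
  whose denominators \<open>y ^ (r\<^sup>2)\<close> clears exactly, the first r odd numbers having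
  sum r^2.\<close>

lemma euler_sqdist_sums:
  fixes b y :: complex
  assumes y: "norm y < 1" "y \<noteq> 0"
  shows "(\<lambda>s. y ^ sqdist r s / qpoch (y\<^sup>2) (y\<^sup>2) s * b ^ s) sums
    ((\<Prod>j<r. b + y * (y\<^sup>2) ^ j) * qpoch_inf (- (b * y)) (y\<^sup>2))"
proof -
  have y2: "norm (y\<^sup>2) < 1"
    using y by (simp add: norm_power power_less_one_iff)
  have prod_rec: "y ^ (r\<^sup>2) * qpoch_inf (- (b / y ^ (2 * r) * y)) (y\<^sup>2)
      = (\<Prod>j<r. b + y * (y\<^sup>2) ^ j) * qpoch_inf (- (b * y)) (y\<^sup>2)"
  proof (induction r)
    case (Suc r)
    \<comment> \<open>Raising r by one adds the leading factor 1 + b/y^(2r+1), and (r+1)^2 - r^2 =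
      2r+1 supplies the power of y that clears it.\<close>
    have "qpoch_inf (- (b / y ^ (2 * Suc r) * y)) (y\<^sup>2)
        = (1 + b / y ^ (2 * Suc r) * y) * qpoch_inf (- (b / y ^ (2 * r) * y)) (y\<^sup>2)"
      using qpoch_inf_rec[OF y2, of "- (b / y ^ (2 * Suc r) * y)"] y(2)
      by (simp add: power2_eq_square field_simps)
    moreover have "y ^ ((Suc r)\<^sup>2) * (1 + b / y ^ (2 * Suc r) * y) = (b + y * (y\<^sup>2) ^ r) * y ^ (r\<^sup>2)"
    proof -
      have "y ^ ((Suc r)\<^sup>2) = y ^ (r\<^sup>2) * (y * (y\<^sup>2) ^ r)"
        by (simp add: power2_eq_square power_add power_mult_distrib mult_ac)
      moreover have "y * (y\<^sup>2) ^ r * (b / y ^ (2 * Suc r) * y) = b"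
        using y(2) by (simp add: power_mult power2_eq_square)
      ultimately show ?thesis
        by (simp add: algebra_simps)
    qed
    ultimately have "y ^ ((Suc r)\<^sup>2) * qpoch_inf (- (b / y ^ (2 * Suc r) * y)) (y\<^sup>2)
        = (b + y * (y\<^sup>2) ^ r) * (y ^ (r\<^sup>2) * qpoch_inf (- (b / y ^ (2 * r) * y)) (y\<^sup>2))"
      by (metis (no_types, lifting) mult.assoc)
    also have "\<dots> = (\<Prod>j<Suc r. b + y * (y\<^sup>2) ^ j) * qpoch_inf (- (b * y)) (y\<^sup>2)"
      unfolding Suc by (simp add: mult_ac)
    finally show ?case .
  qed simp
  have "y ^ (r\<^sup>2) * (y ^ (s\<^sup>2) / qpoch (y\<^sup>2) (y\<^sup>2) s * (b / y ^ (2 * r)) ^ s)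
      = y ^ sqdist r s / qpoch (y\<^sup>2) (y\<^sup>2) s * b ^ s" for s
  proof -
    have "y ^ (r\<^sup>2) * y ^ (s\<^sup>2) = y ^ sqdist r s * (y ^ (2 * r)) ^ s"
      using sqdist_add[of r s] by (simp add: power_add[symmetric] power_mult[symmetric] mult.assoc)
    then have "y ^ (r\<^sup>2) * y ^ (s\<^sup>2) / (y ^ (2 * r)) ^ s = y ^ sqdist r s"
      using y(2) by simp
    moreover have "y ^ (r\<^sup>2) * (y ^ (s\<^sup>2) / P * (b / y ^ (2 * r)) ^ s)
        = y ^ (r\<^sup>2) * y ^ (s\<^sup>2) / (y ^ (2 * r)) ^ s / P * b ^ s" for P
      by (simp add: power_divide mult_ac)
    ultimately show ?thesis
      by simp
  qed
  with sums_mult[OF euler_square_sums[OF y(1), of "b / y ^ (2 * r)"], of "y ^ (r\<^sup>2)"]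
  show ?thesis
    by (simp only: prod_rec)
qed

section \<open>Rearrangement of double series\<close>

text \<open>Absolute summability gives a total over all pairs that does not depend on the order;
  grouping by rows identifies it as \<open>S\<close>, and grouping by antidiagonals then yields the
  claim.\<close>

lemma sums_antidiagonals:
  fixes g :: "nat \<times> nat \<Rightarrow> 'a::banach"
  assumes abs: "(\<lambda>p. norm (g p)) summable_on UNIV"
    and inner: "\<And>r. (\<lambda>s. g (r, s)) sums h r" and outer: "h sums S"
  shows "(\<lambda>n. \<Sum>r\<le>n. g (r, n - r)) sums S"
proof -
  have summ: "g summable_on UNIV \<times> UNIV"
    using abs_summable_summable[OF abs] by simp
  then obtain T where T: "(g has_sum T) (UNIV \<times> UNIV)"
    by (auto simp: summable_on_def)
  have "((\<lambda>s. g (r, s)) has_sum h r) UNIV" for r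
  proof -
    have "g summable_on range (Pair r)"
      using summ by (rule summable_on_subset_banach) simp
    then have "(\<lambda>s. g (r, s)) summable_on UNIV"
      by (subst (asm) summable_on_reindex) (auto simp: inj_on_def o_def)
    then obtain t where "((\<lambda>s. g (r, s)) has_sum t) UNIV"
      by (auto simp: summable_on_def)
    with has_sum_imp_sums[OF this] inner[of r] show ?thesis
      using sums_unique2 by blast
  qed
  from has_sum_SigmaD[OF T this] have "h sums T"
    by (rule has_sum_imp_sums)
  with outer have "T = S"
    using sums_unique2 by blast
  \<comment> \<open>The triangle \<open>r \<le> n\<close> corresponds bijectively to all pairs; on
    it \<open>n - r\<close> is a true subtraction.\<close>
  have "((\<lambda>(n, r). g (r, n - r)) has_sum S) (SIGMA n:UNIV. {..n})"
    using T unfolding \<open>T = S\<close>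
    by (subst has_sum_reindex_bij_witness[where i = "\<lambda>(r, s). (r + s, r)" and j = "\<lambda>(n, r). (r, n - r)"
          and T = "UNIV \<times> UNIV" and h = g and s' = S]) auto
  then have "((\<lambda>n. \<Sum>r\<le>n. g (r, n - r)) has_sum S) UNIV"
    by (rule has_sum_SigmaD) (auto intro: has_sum_finiteI)
  then show ?thesis
    by (rule has_sum_imp_sums)
qed

text \<open>Supplies the majorant for the double series: the row sums
  \<open>a ^ r * (1 / (1 - b))\<close> are again geometric.\<close>

lemma abs_summable_on_geometric_pairs:
  fixes a b :: real
  assumes "0 \<le> a" "a < 1" "0 \<le> b" "b < 1"
  shows "(\<lambda>(r, s). a ^ r * b ^ s) summable_on (UNIV :: (nat \<times> nat) set)"
proof -
  have geo: "((\<lambda>n. c ^ n) has_sum (1 / (1 - c))) UNIV" if "0 \<le> c" "c < 1" for c :: real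
    using that by (intro sums_nonneg_imp_has_sum geometric_sums) auto
  have "(\<lambda>(r, s). a ^ r * b ^ s) summable_on (UNIV \<times> UNIV :: (nat \<times> nat) set)"
  proof (rule summable_on_SigmaI)
    show "((\<lambda>s. case (r, s) of (r, s) \<Rightarrow> a ^ r * b ^ s) has_sum a ^ r * (1 / (1 - b))) UNIV" for r
      unfolding prod.case using geo[of b] assms by (intro has_sum_cmult_right) auto
    show "(\<lambda>r. a ^ r * (1 / (1 - b))) summable_on UNIV"
      using geo[of a] assms by (intro summable_on_cmult_left) (auto simp: summable_on_def)
  qed (use assms in auto)
  then show ?thesis by simp
qed

section \<open>Evaluation of the double series\<close>

theorem sqdist_double_sums:
  fixes a b y :: complex
  assumes y: "norm y < 1" "y \<noteq> 0" and a: "norm a < 1" and b: "norm b < 1"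
  shows "(\<lambda>n. \<Sum>r\<le>n. a ^ r * b ^ (n - r) * y ^ sqdist r (n - r) /
            (qpoch (y\<^sup>2) (y\<^sup>2) r * qpoch (y\<^sup>2) (y\<^sup>2) (n - r))) sums
    (qpoch_inf (- (a * y)) (y\<^sup>2) * qpoch_inf (- (b * y)) (y\<^sup>2) / qpoch_inf (a * b) (y\<^sup>2))"
proof -
  define g where "g = (\<lambda>(r, s). a ^ r * b ^ s * y ^ sqdist r s /
      (qpoch (y\<^sup>2) (y\<^sup>2) r * qpoch (y\<^sup>2) (y\<^sup>2) s))"
  have y2: "norm (y\<^sup>2) < 1"
    using y by (simp add: norm_power power_less_one_iff)
  have ab: "norm (a * b) < 1"
    using mult_strict_mono'[OF a b] by (simp add: norm_mult)
  obtain K where K: "0 < K" "\<And>n. norm (1 / qpoch (y\<^sup>2) (y\<^sup>2) n) \<le> K"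
    using inverse_qpoch_bounded[OF y2 y2] by blast
  have "(\<lambda>p. norm (g p)) summable_on UNIV"
  proof (rule Infinite_Sum.abs_summable_on_comparison_test')
    show "(\<lambda>p. K\<^sup>2 * (case p of (r, s) \<Rightarrow> norm a ^ r * norm b ^ s)) summable_on UNIV"
      using a b by (intro summable_on_cmult_right abs_summable_on_geometric_pairs) auto
    fix p :: "nat \<times> nat"
    obtain r s where p: "p = (r, s)" by force
    \<comment> \<open>The power of y has norm at most 1 and each reciprocal symbol at most
      \<open>K\<close>, which leaves a product of geometric terms.\<close>
    have "norm (g p) = norm y ^ sqdist r s *
        (norm (1 / qpoch (y\<^sup>2) (y\<^sup>2) r) * norm (1 / qpoch (y\<^sup>2) (y\<^sup>2) s)) * (norm a ^ r * norm b ^ s)"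
      by (simp add: g_def p norm_mult norm_divide norm_power mult_ac)
    also have "\<dots> \<le> 1 * (K * K) * (norm a ^ r * norm b ^ s)"
      using y K by (intro mult_right_mono mult_mono power_le_one) auto
    finally show "norm (g p) \<le> K\<^sup>2 * (case p of (r, s) \<Rightarrow> norm a ^ r * norm b ^ s)"
      by (simp add: p power2_eq_square)
  qed
  \<comment> \<open>The row sum is written with \<open>- (- y)\<close> so that it matches the
    summand of \<open>q_binomial\<close> with \<open>c := - y\<close>.\<close>
  moreover have "(\<lambda>s. g (r, s)) sums (qpoch_inf (- (b * y)) (y\<^sup>2) *
      ((\<Prod>j<r. b - (- y) * (y\<^sup>2) ^ j) / qpoch (y\<^sup>2) (y\<^sup>2) r * a ^ r))" for r
    using sums_mult[OF euler_sqdist_sums[OF y, of r b], of "a ^ r / qpoch (y\<^sup>2) (y\<^sup>2) r"]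
    by (simp add: g_def mult_ac)
  moreover have "(\<lambda>r. qpoch_inf (- (b * y)) (y\<^sup>2) *
      ((\<Prod>j<r. b - (- y) * (y\<^sup>2) ^ j) / qpoch (y\<^sup>2) (y\<^sup>2) r * a ^ r)) sums
      (qpoch_inf (- (b * y)) (y\<^sup>2) * (qpoch_inf (a * (- y)) (y\<^sup>2) / qpoch_inf (a * b) (y\<^sup>2)))"
    by (intro sums_mult q_binomial y2 ab)
  ultimately have "(\<lambda>n. \<Sum>r\<le>n. g (r, n - r)) sums (qpoch_inf (- (b * y)) (y\<^sup>2) *
      (qpoch_inf (a * (- y)) (y\<^sup>2) / qpoch_inf (a * b) (y\<^sup>2)))"
    by (rule sums_antidiagonals)
  then show ?thesis
    by (simp add: g_def mult_ac)
qed

section \<open>Symplectic group orders and the final identity\<close>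

text \<open>Pulling q^(2i) out of each factor contributes m^2 + m to the exponent, on top of the m^2
  already there.\<close>

lemma Sp_order_eq_qpoch:
  assumes "q \<noteq> 0"
  shows "Sp_order m q = q ^ (2 * m\<^sup>2 + m) * qpoch ((1 / q)\<^sup>2) ((1 / q)\<^sup>2) m"
proof (induction m)
  case (Suc m)
  have "Sp_order (Suc m) q = Sp_order m q * (q ^ (2 * m + 1) * (q ^ (2 * Suc m) - 1))"
  proof -
    have "q ^ ((Suc m)\<^sup>2) = q ^ (m\<^sup>2) * q ^ (2 * m + 1)"
      unfolding power_add[symmetric] by (rule arg_cong) (simp add: power2_eq_square)
    then show ?thesis
      by (simp add: Sp_order_def mult_ac)
  qed
  moreover have "q ^ (2 * Suc m) - 1 = q ^ (2 * Suc m) * (1 - (1 / q)\<^sup>2 * ((1 / q)\<^sup>2) ^ m)"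
    using assms by (simp add: power_divide power_mult right_diff_distrib power2_eq_square[of q])
  moreover have eq: "2 * (Suc m)\<^sup>2 + Suc m = (2 * m\<^sup>2 + m) + (2 * m + 1) + (2 * Suc m)"
    by (simp add: power2_eq_square)
  ultimately show ?case
    unfolding qpoch_Suc eq power_add[of q _ "2 * Suc m"] power_add[of q _ "2 * m + 1"] Suc
    by (simp only: mult_ac)
qed (simp add: Sp_order_def)

text \<open>The convergence conjuncts ensure that both infinite products are genuine limits and not
  default values; \<open>Suc i\<close> makes their factors start at exponent 2.\<close>

theorem theorem2p9:
  fixes q :: real and u :: complex
  assumes "q > 1" and "norm u < q"
  shows "convergent_prod (\<lambda>i. (1 + u / complex_of_real q ^ (2 * Suc i))\<^sup>2) \<and>
    convergent_prod (\<lambda>i. 1 - u\<^sup>2 / complex_of_real q ^ (2 * Suc i)) \<and>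
    (\<lambda>n. u ^ n * complex_of_real q ^ (n\<^sup>2) *
            (\<Sum>r=0..n. 1 / complex_of_real (Sp_order r q * Sp_order (n - r) q)))
         sums
         ((\<Prod>i. (1 + u / complex_of_real q ^ (2 * Suc i))\<^sup>2) /
          (\<Prod>i. (1 - u\<^sup>2 / complex_of_real q ^ (2 * Suc i))))"
proof -
  define Q where "Q = complex_of_real q"
  define y where "y = 1 / Q"
  define z where "z = u * y"
  have Q0: "Q \<noteq> 0" and Qy: "Q * y = 1"
    using assms by (auto simp: Q_def y_def)
  have y: "norm y < 1" "y \<noteq> 0" and z: "norm z < 1"
    using assms by (auto simp: Q_def y_def z_def norm_divide)
  have y2: "norm (y\<^sup>2) < 1"
    using y by (simp add: norm_power power_less_one_iff)
  have num: "1 + u / Q ^ (2 * Suc i) = 1 - (- (z * y)) * (y\<^sup>2) ^ i" for i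
    using Q0 by (simp add: y_def z_def power_divide power_mult power2_eq_square field_simps)
  have den: "1 - u\<^sup>2 / Q ^ (2 * Suc i) = 1 - (z * z) * (y\<^sup>2) ^ i" for i
    using Q0 by (simp add: y_def z_def power_divide power_mult power2_eq_square field_simps)
  note conv = convergent_prod_qpoch[OF y2]
  have num_inf: "(\<Prod>i. (1 + u / Q ^ (2 * Suc i))\<^sup>2) = qpoch_inf (- (z * y)) (y\<^sup>2) * qpoch_inf (- (z * y)) (y\<^sup>2)"
    unfolding num power2_eq_square[of "1 - _"] qpoch_inf_def by (intro prodinf_mult[symmetric] conv)
  have Sp: "complex_of_real (Sp_order m q) = Q ^ (2 * m\<^sup>2 + m) * qpoch (y\<^sup>2) (y\<^sup>2) m" for m
    using assms by (subst Sp_order_eq_qpoch) (simp_all add: qpoch_def Q_def y_def)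
  have "u ^ n * Q ^ (n\<^sup>2) * (\<Sum>r=0..n. 1 / complex_of_real (Sp_order r q * Sp_order (n - r) q))
      = (\<Sum>r\<le>n. z ^ r * z ^ (n - r) * y ^ sqdist r (n - r) /
            (qpoch (y\<^sup>2) (y\<^sup>2) r * qpoch (y\<^sup>2) (y\<^sup>2) (n - r)))" for n
    unfolding sum_distrib_left atLeast0AtMost
  proof (rule sum.cong[OF refl])
    fix r assume "r \<in> {..n}"
    then obtain s where n: "n = r + s"
      using le_Suc_ex by auto
    \<comment> \<open>From 2r^2 + 2s^2 = (r+s)^2 + (r-s)^2: after \<open>Q ^ (n\<^sup>2)\<close>
      cancels, \<open>Q ^ n\<close> turns \<open>u ^ n\<close> into \<open>z ^ n\<close> and the
      rest is \<open>y ^ sqdist r s\<close>.\<close>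
    have "(2 * r\<^sup>2 + r) + (2 * s\<^sup>2 + s) = n\<^sup>2 + (n + sqdist r s)"
      using sqdist_add[of r s] by (simp add: n power2_eq_square algebra_simps)
    then have "Q ^ (2 * r\<^sup>2 + r) * Q ^ (2 * s\<^sup>2 + s) = Q ^ (n\<^sup>2) * Q ^ (n + sqdist r s)"
      by (metis power_add)
    moreover have "z ^ n * y ^ sqdist r s = u ^ n / Q ^ (n + sqdist r s)"
      by (simp add: z_def y_def power_divide power_add)
    ultimately have "u ^ n * Q ^ (n\<^sup>2) / (Q ^ (2 * r\<^sup>2 + r) * Q ^ (2 * s\<^sup>2 + s)) = z ^ n * y ^ sqdist r s"
      using Q0 by simp
    then have "z ^ n * y ^ sqdist r s / (qpoch (y\<^sup>2) (y\<^sup>2) r * qpoch (y\<^sup>2) (y\<^sup>2) s)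
      = u ^ n * Q ^ (n\<^sup>2) / (Q ^ (2 * r\<^sup>2 + r) * Q ^ (2 * s\<^sup>2 + s)) /
        (qpoch (y\<^sup>2) (y\<^sup>2) r * qpoch (y\<^sup>2) (y\<^sup>2) s)"
      by simp
    then show "u ^ n * Q ^ (n\<^sup>2) * (1 / complex_of_real (Sp_order r q * Sp_order (n - r) q))
      = z ^ r * z ^ (n - r) * y ^ sqdist r (n - r) /
            (qpoch (y\<^sup>2) (y\<^sup>2) r * qpoch (y\<^sup>2) (y\<^sup>2) (n - r))"
      by (simp add: n Sp power_add[of z] mult_ac)
  qed
  \<comment> \<open>Both parameters of the double series are \<open>z\<close>, so the two numerator
    products coincide and give the square.\<close>
  then have "(\<lambda>n. u ^ n * Q ^ (n\<^sup>2) *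
        (\<Sum>r=0..n. 1 / complex_of_real (Sp_order r q * Sp_order (n - r) q))) sums
      ((\<Prod>i. (1 + u / Q ^ (2 * Suc i))\<^sup>2) / (\<Prod>i. (1 - u\<^sup>2 / Q ^ (2 * Suc i))))"
    using sqdist_double_sums[OF y z z] unfolding num_inf den qpoch_inf_def[of "z * z"] by simp
  moreover have "convergent_prod (\<lambda>i. (1 + u / Q ^ (2 * Suc i))\<^sup>2)"
    unfolding num power2_eq_square[of "1 - _"] by (intro convergent_prod_mult conv)
  moreover have "convergent_prod (\<lambda>i. 1 - u\<^sup>2 / Q ^ (2 * Suc i))"
    unfolding den by (rule conv)
  ultimately show ?thesis
    unfolding Q_def by blast
qed

end
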